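(* For the $3$-dimensional complex associative algebras listed in the context, the following jump deformations exist: - $d_1$ has jump deformations to $d_2,d_6,d_{10},d_{11},d_{12},d_{14}$; - $d_2$ has jump deformations to $d_6,d_{12},d_{14}$; - $d_3$ has jump deformations to $d_{11},d_{13}$; - $d_4$ has jump deformations to $d_{10},d_{13}$; - $d_5$ has jump deformations to $d_6,d_{12},d_{14}$; - $d_6$ has a jump deformation to $d_{14}$, and to no other listed algebra; - $d_9$ has a jump deformation to $d_{10}$, and to no other listed algebra; - $d_{12}$ has a jump deformation to $d_{14}$, and to no other listed algebra; - $d_{16}$ has jump deformations to $d_2,d_5,d_6,d_{12},d_{14},d_{19}$; - $d_{17}$ has a jump deformation to $d_{11}$, and to no other listed algebra; - $d_{18}$ has jump deformations to $d_{12},d_{13},d_{14},d_{19}$; - $d_{19}$ has jump deformations to $d_{12},d_{14}$.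
   Context: Associative algebras are not assumed unital or commutative. $V$ is a complex vector space with basis $e_1,e_2,e_3$, and $\psi^{i,j}_k$ denotes the bilinear map $V\times V\to V$ with $\psi^{i,j}_k(e_i,e_j)=e_k$ and $\psi^{i,j}_k(e_m,e_n)=0$ for $(m,n)\neq(i,j)$. An algebra structure is identified with its product $d$. A jump deformation from $d$ to a non-isomorphic structure $d'$ is a family $d_t=d+t\psi_1+t^2\psi_2+\cdots$ of associative products on $V$ (with bilinear $\psi_i:V\times V\to V$), given by a power series convergent for small $t$, such that $d_t$ is isomorphic to $d'$ for all sufficiently small $t\neq 0$. The list of products is: $d_1=\psi^{1,1}_1$; $d_2=\psi^{1,1}_1+\psi^{2,2}_3$; $d_3=\psi^{1,1}_1+\psi^{1,3}_3$; $d_4=\psi^{1,1}_1+\psi^{3,1}_3$; $d_5=\psi^{1,1}_1+\psi^{1,3}_3+\psi^{3,1}_3$; $d_6=\psi^{1,1}_1+\psi^{3,3}_3$; $d_7=\psi^{1,1}_1+\psi^{2,1}_2+\psi^{1,3}_3$; $d_8=\psi^{1,1}_1+\psi^{2,1}_2+\psi^{3,1}_3$; $d_9=\psi^{1,1}_1+\psi^{2,1}_2+\psi^{1,3}_3+\psi^{3,1}_3$; $d_{10}=\psi^{1,1}_1+\psi^{2,1}_2+\psi^{3,3}_3$; $d_{11}=\psi^{1,1}_1+\psi^{2,2}_2+\psi^{2,3}_3$; $d_{12}=\psi^{1,1}_1+\psi^{2,2}_2+\psi^{2,3}_3+\psi^{3,2}_3$; $d_{13}=\psi^{1,1}_1+\psi^{2,2}_2+\psi^{2,3}_3+\psi^{3,1}_3$;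 $d_{14}=\psi^{1,1}_1+\psi^{2,2}_2+\psi^{3,3}_3$; $d_{15}=\psi^{1,1}_2$; $d_{16}=\psi^{1,1}_2+\psi^{1,2}_3+\psi^{2,1}_3$; $d_{17}=\psi^{1,1}_1+\psi^{1,1}_2+\psi^{1,2}_2+\psi^{2,1}_2+\psi^{1,3}_3$; $d_{18}=\psi^{1,1}_1+\psi^{1,1}_2+\psi^{1,2}_2+\psi^{2,1}_2+\psi^{1,3}_3+\psi^{3,1}_3$; $d_{19}=\psi^{3,3}_3+\psi^{1,1}_2+\psi^{1,3}_1+\psi^{3,1}_1+\psi^{2,3}_2+\psi^{3,2}_2$; $d_{20}=\psi^{1,1}_1+\psi^{1,2}_2+\psi^{1,3}_3$; $d_{21}=\psi^{1,1}_3+\psi^{1,2}_3-\psi^{2,1}_3$; $d_{22}(x:y)=x\,\psi^{1,2}_3+y\,\psi^{2,1}_3$ for $(x:y)\in\mathbb{P}^1(\mathbb{C})$. *)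

theory Defs
  imports "HOL-Analysis.Analysis" "HOL-Library.Function_Algebras"
begin

text \<open>\<open>V\<close> is \<open>\<complex>\<^sup>3\<close> with its standard basis \<open>e i = axis i 1\<close>; in the index type \<open>3\<close> the numeral
  \<open>3\<close> denotes the same index as \<open>0\<close>, so \<open>1\<close>, \<open>2\<close>, \<open>3\<close> are its three distinct elements. Linearity
  is always complex linearity, i.e. with respect to \<open>(*s)\<close>, not the real scaling \<open>(*\<^sub>R)\<close>.
  Sums of products are pointwise.\<close>

type_synonym V = "complex ^ 3"

type_synonym product = "V \<Rightarrow> V \<Rightarrow> V"

definition clinear :: "(V \<Rightarrow> V) \<Rightarrow> bool" where
  "clinear f \<longleftrightarrow> Vector_Spaces.linear (*s) (*s) f"

definition cbilinear :: "product \<Rightarrow> bool" where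
  "cbilinear d \<longleftrightarrow> (\<forall>x. clinear (\<lambda>y. d x y)) \<and> (\<forall>y. clinear (\<lambda>x. d x y))"

definition associative_product :: "product \<Rightarrow> bool" where
  "associative_product d \<longleftrightarrow> cbilinear d \<and> (\<forall>x y z. d (d x y) z = d x (d y z))"

definition isomorphic_products :: "product \<Rightarrow> product \<Rightarrow> bool" where
  "isomorphic_products d d' \<longleftrightarrow>
     (\<exists>\<phi>. clinear \<phi> \<and> bij \<phi> \<and> (\<forall>x y. \<phi> (d x y) = d' (\<phi> x) (\<phi> y)))"

definition power_series_product :: "(nat \<Rightarrow> product) \<Rightarrow> complex \<Rightarrow> product" where
  "power_series_product \<psi> t = (\<lambda>x y. \<Sum>n. t ^ n *s \<psi> n x y)"

definition jump_deformation :: "product \<Rightarrow> product \<Rightarrow> bool" where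
  "jump_deformation d d' \<longleftrightarrow>
     \<not> isomorphic_products d d' \<and>
     (\<exists>\<psi> \<epsilon>. (\<forall>n. cbilinear (\<psi> n)) \<and> \<psi> 0 = d \<and> \<epsilon> > 0 \<and>
        (\<forall>t. norm t < \<epsilon> \<longrightarrow>
           (\<forall>x y. summable (\<lambda>n. t ^ n *s \<psi> n x y)) \<and>
           associative_product (power_series_product \<psi> t) \<and>
           (t \<noteq> 0 \<longrightarrow> isomorphic_products (power_series_product \<psi> t) d')))"

definition psi :: "3 \<Rightarrow> 3 \<Rightarrow> 3 \<Rightarrow> product" where
  "psi i j k = (\<lambda>x y. (x $ i * y $ j) *s axis k 1)"

lemma psi_axis: "psi i j k (axis m 1) (axis n 1) = (if m = i \<and> n = j then axis k 1 else 0)"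
  by (auto simp: psi_def axis_def vec_eq_iff)

lemma cbilinear_psi: "cbilinear (psi i j k)"
  unfolding cbilinear_def clinear_def psi_def
  by (auto simp: Vector_Spaces.linear_iff vec.vector_space_axioms vec_eq_iff algebra_simps)

definition "d1 = psi 1 1 1"
definition "d2 = psi 1 1 1 + psi 2 2 3"
definition "d3 = psi 1 1 1 + psi 1 3 3"
definition "d4 = psi 1 1 1 + psi 3 1 3"
definition "d5 = psi 1 1 1 + psi 1 3 3 + psi 3 1 3"
definition "d6 = psi 1 1 1 + psi 3 3 3"
definition "d7 = psi 1 1 1 + psi 2 1 2 + psi 1 3 3"
definition "d8 = psi 1 1 1 + psi 2 1 2 + psi 3 1 3"
definition "d9 = psi 1 1 1 + psi 2 1 2 + psi 1 3 3 + psi 3 1 3"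
definition "d10 = psi 1 1 1 + psi 2 1 2 + psi 3 3 3"
definition "d11 = psi 1 1 1 + psi 2 2 2 + psi 2 3 3"
definition "d12 = psi 1 1 1 + psi 2 2 2 + psi 2 3 3 + psi 3 2 3"
definition "d13 = psi 1 1 1 + psi 2 2 2 + psi 2 3 3 + psi 3 1 3"
definition "d14 = psi 1 1 1 + psi 2 2 2 + psi 3 3 3"
definition "d15 = psi 1 1 2"
definition "d16 = psi 1 1 2 + psi 1 2 3 + psi 2 1 3"
definition "d17 = psi 1 1 1 + psi 1 1 2 + psi 1 2 2 + psi 2 1 2 + psi 1 3 3"
definition "d18 = psi 1 1 1 + psi 1 1 2 + psi 1 2 2 + psi 2 1 2 + psi 1 3 3 + psi 3 1 3"
definition "d19 = psi 3 3 3 + psi 1 1 2 + psi 1 3 1 + psi 3 1 1 + psi 2 3 2 + psi 3 2 2"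
definition "d20 = psi 1 1 1 + psi 1 2 2 + psi 1 3 3"
definition "d21 = psi 1 1 3 + psi 1 2 3 - psi 2 1 3"

definition d22 :: "complex \<Rightarrow> complex \<Rightarrow> product" where
  "d22 p q = (\<lambda>x y. p *s psi 1 2 3 x y + q *s psi 2 1 3 x y)"

text \<open>A point \<open>(p : q)\<close> of the projective line is represented by all of its homogeneous coordinates;
  rescaling them changes \<open>d22 p q\<close> only by an isomorphism.\<close>

definition listed_products :: "product set" where
  "listed_products =
     {d1, d2, d3, d4, d5, d6, d7, d8, d9, d10, d11, d12, d13, d14, d15, d16, d17, d18, d19, d20, d21}
     \<union> {d22 p q | p q. (p, q) \<noteq> (0, 0)}"

end

theory Submission
  imports Defs
begin

text \<open>Both directions come from comparing a family \<open>D\<^sub>t\<close> with its limit \<open>d\<close>.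

Existence. If \<open>d'\<close> is associative and an invertible linear map \<open>\<phi>\<^sub>t\<close>, given for \<open>t \<noteq> 0\<close>, pulls \<open>d'\<close>
back to a product that is polynomial in \<open>t\<close> with constant term \<open>d\<close>, then this polynomial is a jump
deformation: associativity for \<open>t \<noteq> 0\<close> is inherited from \<open>d'\<close>, and convergence is trivial
(\<open>jump_deformationI\<close>). All the families are of this kind. Most of them let a vector of square zero in
\<open>d\<close> have the square \<open>t\<close> times itself, which makes it \<open>t\<close> times an idempotent. The algebras
\<open>d2\<close>, \<open>d16\<close> and \<open>d19\<close> contain \<open>x\<complex>[x]\<close> or \<open>\<complex>[x]\<close> modulo a power of \<open>x\<close>; there the roots of the modulus are moved from \<open>0\<close> to
multiples of \<open>t\<close>, and a Newton basis such as \<open>x, x(x - at), x(x - at)(x - bt)\<close> makes the structure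
constants polynomial in \<open>t\<close>.

Obstructions. Let \<open>L\<^sub>x\<close> and \<open>R\<^sub>x\<close> be left and right multiplication by \<open>x\<close>. A polynomial
relation between the traces of \<open>L\<close> and \<open>R\<close> at the powers of \<open>x\<close> that holds for all \<open>x\<close> is preserved
by isomorphism, and, being a closed condition on the product, also by the limit \<open>t \<rightarrow> 0\<close>
(\<open>jump_deformation_satisfies\<close>). So \<open>d\<close> cannot jump to \<open>d'\<close> when some such relation holds in \<open>d'\<close>
and fails in \<open>d\<close>. In the listed algebras the eigenvalues of \<open>L\<^sub>x\<close> and \<open>R\<^sub>x\<close> are coordinates of \<open>x\<close> or \<open>0\<close>,
and four relations, with their mirror images, suffice: vanishing determinant, vanishing discriminant,
proportionality of the two traces, and one relation modelled on the upper triangular matrices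
\<open>d13\<close>. Trace relations also show that source and target of a jump are not isomorphic, except for the pairs
\<open>d1\<close>, \<open>d2\<close> and \<open>d18\<close>, \<open>d19\<close>, whose members have the same traces up to the choice of
coordinates; there the squares of the elements of trace zero decide.\<close>


section \<open>Bilinear products\<close>

lemma psi_nth: "psi i j k x y $ m = (if m = k then x $ i * y $ j else 0)"
  by (simp add: psi_def axis_def)

lemma cbilinear_iff:
  "cbilinear d \<longleftrightarrow>
     (\<forall>x y z. d (x + y) z = d x z + d y z) \<and> (\<forall>c x z. d (c *s x) z = c *s d x z) \<and>
     (\<forall>x y z. d z (x + y) = d z x + d z y) \<and> (\<forall>c x z. d z (c *s x) = c *s d z x)"
  unfolding cbilinear_def clinear_def Vector_Spaces.linear_iff
  by (auto simp: vec.vector_space_axioms)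

lemma cbilinear_add: "cbilinear a \<Longrightarrow> cbilinear b \<Longrightarrow> cbilinear (a + b)"
  by (simp add: cbilinear_iff algebra_simps vec.scale_right_distrib)

lemma cbilinear_zero: "cbilinear 0"
  by (simp add: cbilinear_iff)

definition scale :: "complex \<Rightarrow> product \<Rightarrow> product" where
  "scale c d = (\<lambda>x y. c *s d x y)"

lemma cbilinear_scale: "cbilinear d \<Longrightarrow> cbilinear (scale c d)"
  by (simp add: scale_def cbilinear_iff algebra_simps vec.scale_right_distrib)

lemma vec_axis_expand: "(x :: V) = x $ 1 *s axis 1 1 + x $ 2 *s axis 2 1 + x $ 3 *s axis 3 1"
  by (simp add: vec_eq_iff forall_3 axis_def)

lemma cbilinear_expand:
  assumes "cbilinear d"
  shows "d x y = (\<Sum>i\<in>UNIV. \<Sum>j\<in>UNIV. (x $ i * y $ j) *s d (axis i 1) (axis j 1))"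
proof -
  have "d x y = d (x $ 1 *s axis 1 1 + x $ 2 *s axis 2 1 + x $ 3 *s axis 3 1)
                  (y $ 1 *s axis 1 1 + y $ 2 *s axis 2 1 + y $ 3 *s axis 3 1)"
    using vec_axis_expand[of x] vec_axis_expand[of y] by simp
  also have "\<dots> = (\<Sum>i\<in>UNIV. \<Sum>j\<in>UNIV. (x $ i * y $ j) *s d (axis i 1) (axis j 1))"
    using assms
    by (simp add: cbilinear_iff sum_3 vec.scale_right_distrib algebra_simps)
  finally show ?thesis .
qed

lemma associative_listed:
  "associative_product d1" "associative_product d2" "associative_product d3"
  "associative_product d4" "associative_product d5" "associative_product d6"
  "associative_product d9" "associative_product d10" "associative_product d11"
  "associative_product d12" "associative_product d13" "associative_product d14"
  "associative_product d16" "associative_product d17" "associative_product d18"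
  "associative_product d19"
  unfolding associative_product_def d1_def d2_def d3_def d4_def d5_def d6_def d9_def d10_def
    d11_def d12_def d13_def d14_def d16_def d17_def d18_def d19_def
  by (auto intro!: cbilinear_add cbilinear_psi
      simp: vec_eq_iff forall_3 psi_nth algebra_simps)

section \<open>Polynomial families of products\<close>

fun horner :: "product list \<Rightarrow> complex \<Rightarrow> product" where
  "horner [] t = 0"
| "horner (b # bs) t = b + scale t (horner bs t)"

definition coefficient :: "product list \<Rightarrow> nat \<Rightarrow> product" where
  "coefficient bs n = (if n < length bs then bs ! n else 0)"

lemma horner_conv_sum: "horner bs t x y = (\<Sum>n<length bs. t ^ n *s coefficient bs n x y)"
proof (induction bs)
  case (Cons b bs)
  have "(\<Sum>n<length (b # bs). t ^ n *s coefficient (b # bs) n x y) =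
      b x y + (\<Sum>n<length bs. t *s (t ^ n *s coefficient bs n x y))"
    by (simp add: sum.lessThan_Suc_shift coefficient_def del: sum.lessThan_Suc)
  also have "\<dots> = horner (b # bs) t x y"
    by (simp add: Cons.IH scale_def vec.scale_sum_right del: vec.scale_scale)
  finally show ?case by simp
qed simp

lemma horner_sums: "(\<lambda>n. t ^ n *s coefficient bs n x y) sums horner bs t x y"
  unfolding horner_conv_sum
  by (rule sums_finite) (auto simp: coefficient_def)

lemma power_series_product_coefficient: "power_series_product (coefficient bs) t = horner bs t"
  unfolding power_series_product_def
  by (intro ext) (simp add: sums_unique[OF horner_sums, symmetric])

lemma cbilinear_horner: "(\<And>b. b \<in> set bs \<Longrightarrow> cbilinear b) \<Longrightarrow> cbilinear (horner bs t)"
  by (induction bs) (simp_all add: cbilinear_zero cbilinear_add cbilinear_scale)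

lemma associative_transport:
  assumes "cbilinear d" "associative_product d'" "inj \<phi>"
    "\<And>x y. \<phi> (d x y) = d' (\<phi> x) (\<phi> y)"
  shows "associative_product d"
  using assms unfolding associative_product_def by (metis injD)

lemma clinear_bij:
  assumes "clinear \<phi>" "\<And>x. \<phi> x = 0 \<Longrightarrow> x = 0"
  shows "bij \<phi>"
proof -
  have lin: "Vector_Spaces.linear (*s) (*s) \<phi>" using assms(1) by (simp add: clinear_def)
  have "inj \<phi>"
  proof (rule injI)
    fix x y assume "\<phi> x = \<phi> y"
    then have "\<phi> (x - y) = 0" using vec.linear_diff[OF lin] by simp
    with assms(2) show "x = y" by fastforce
  qed
  with lin show ?thesis by (simp add: bij_def vec.linear_inj_imp_surj)
qed

definition basis_map :: "V \<Rightarrow> V \<Rightarrow> V \<Rightarrow> V \<Rightarrow> V" where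
  "basis_map u v w x = x $ 1 *s u + x $ 2 *s v + x $ 3 *s w"

lemma clinear_basis_map: "clinear (basis_map u v w)"
  unfolding clinear_def Vector_Spaces.linear_iff basis_map_def
  by (auto simp: vec.vector_space_axioms vec_eq_iff algebra_simps)

text \<open>Associativity of the family need not be checked on the structure constants: for \<open>t \<noteq> 0\<close> it is
pulled back from \<open>d'\<close>, and at \<open>t = 0\<close> the family is \<open>d\<close>. The vectors \<open>u t, v t, w t\<close> are the images
of the standard basis under the isomorphism onto \<open>d'\<close>.\<close>
lemma jump_deformationI:
  assumes "\<not> isomorphic_products d d'" "associative_product d" "associative_product d'"
    and bs: "\<And>b. b \<in> set bs \<Longrightarrow> cbilinear b"
    and inj: "\<And>t x. t \<noteq> 0 \<Longrightarrow> basis_map (u t) (v t) (w t) x = 0 \<Longrightarrow> x = 0"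
    and hom: "\<And>t x y. t \<noteq> 0 \<Longrightarrow> basis_map (u t) (v t) (w t) (horner (d # bs) t x y) =
      d' (basis_map (u t) (v t) (w t) x) (basis_map (u t) (v t) (w t) y)"
  shows "jump_deformation d d'"
proof -
  let ?\<psi> = "coefficient (d # bs)"
  have d: "cbilinear d" using assms(2) by (simp add: associative_product_def)
  have bil: "cbilinear (horner (d # bs) t)" for t
    using d bs by (intro cbilinear_horner) auto
  have \<psi>: "cbilinear (?\<psi> n)" for n
    using d bs cbilinear_zero nth_mem[of n "d # bs"] unfolding coefficient_def by auto
  have iso: "isomorphic_products (horner (d # bs) t) d'"
    and assoc: "associative_product (horner (d # bs) t)" if "t \<noteq> 0" for t
  proof -
    let ?\<phi> = "basis_map (u t) (v t) (w t)"
    have bij: "bij ?\<phi>" by (rule clinear_bij[OF clinear_basis_map inj[OF that]])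
    then show "isomorphic_products (horner (d # bs) t) d'"
      unfolding isomorphic_products_def using clinear_basis_map hom[OF that] by blast
    show "associative_product (horner (d # bs) t)"
      using associative_transport[where \<phi> = ?\<phi>, OF bil assms(3) bij_is_inj[OF bij]]
        hom[OF that] by blast
  qed
  have "horner (d # bs) 0 = d" by (intro ext) (simp add: scale_def)
  with assms(2) assoc have assoc': "associative_product (horner (d # bs) t)" for t by metis
  have "\<forall>n. cbilinear (?\<psi> n)" using \<psi> by blast
  moreover have "?\<psi> 0 = d" by (simp add: coefficient_def)
  moreover have "\<forall>t. norm t < 1 \<longrightarrow>
      (\<forall>x y. summable (\<lambda>n. t ^ n *s ?\<psi> n x y)) \<and>
      associative_product (power_series_product ?\<psi> t) \<and>
      (t \<noteq> 0 \<longrightarrow> isomorphic_products (power_series_product ?\<psi> t) d')"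
    unfolding power_series_product_coefficient
    using horner_sums[THEN sums_summable] iso assoc' by blast
  ultimately show ?thesis
    unfolding jump_deformation_def using assms(1) zero_less_one by blast
qed

section \<open>Traces of multiplication operators\<close>

definition left_trace :: "product \<Rightarrow> V \<Rightarrow> complex" where
  "left_trace d x = (\<Sum>i\<in>UNIV. d x (axis i 1) $ i)"

definition right_trace :: "product \<Rightarrow> V \<Rightarrow> complex" where
  "right_trace d x = (\<Sum>i\<in>UNIV. d (axis i 1) x $ i)"

lemma left_trace_psi: "left_trace (psi i j k) x = (if j = k then x $ i else 0)"
  by (simp add: left_trace_def psi_nth axis_def if_distrib cong: if_cong)

lemma right_trace_psi: "right_trace (psi i j k) x = (if i = k then x $ j else 0)"
  by (simp add: right_trace_def psi_nth axis_def if_distrib cong: if_cong)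

lemma left_trace_add: "left_trace (a + b) x = left_trace a x + left_trace b x"
  by (simp add: left_trace_def sum.distrib)

lemma right_trace_add: "right_trace (a + b) x = right_trace a x + right_trace b x"
  by (simp add: right_trace_def sum.distrib)

lemma left_trace_diff: "left_trace (a - b) x = left_trace a x - left_trace b x"
  by (simp add: left_trace_def sum_subtractf)

lemma right_trace_diff: "right_trace (a - b) x = right_trace a x - right_trace b x"
  by (simp add: right_trace_def sum_subtractf)

lemma trace_conjugate:
  fixes f g \<phi> :: "V \<Rightarrow> V"
  assumes f: "clinear f" and g: "clinear g" and \<phi>: "clinear \<phi>" "bij \<phi>"
    and conj: "\<And>x. \<phi> (f x) = g (\<phi> x)"
  shows "(\<Sum>i\<in>UNIV. f (axis i 1) $ i) = (\<Sum>i\<in>UNIV. g (axis i 1) $ i)"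
proof -
  have tr: "trace (matrix h) = (\<Sum>i\<in>UNIV. h (axis i 1) $ i)" for h :: "V \<Rightarrow> V"
    by (simp add: trace_def matrix_def)
  let ?\<psi> = "inv \<phi>"
  have lin: "Vector_Spaces.linear (*s) (*s) f" "Vector_Spaces.linear (*s) (*s) g"
    "Vector_Spaces.linear (*s) (*s) \<phi>" using assms by (simp_all add: clinear_def)
  have \<psi>: "Vector_Spaces.linear (*s) (*s) ?\<psi>"
  proof -
    have "\<phi> (?\<psi> y) = y" for y using \<phi>(2) by (simp add: bij_is_surj surj_f_inv_f)
    moreover have "?\<psi> (\<phi> y) = y" for y using \<phi>(2) by (simp add: bij_is_inj)
    ultimately show ?thesis using lin(3)
      unfolding Vector_Spaces.linear_iff by metis
  qed
  have "g = \<phi> \<circ> (f \<circ> ?\<psi>)"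
    using \<phi>(2) conj by (auto simp: fun_eq_iff bij_is_surj surj_f_inv_f)
  then have "trace (matrix g) = trace (matrix \<phi> ** (matrix f ** matrix ?\<psi>))"
    using matrix_compose_gen[OF \<psi> lin(1)]
      matrix_compose_gen[OF Vector_Spaces.linear_compose[OF \<psi> lin(1)] lin(3)] by simp
  also have "\<dots> = trace (matrix f ** (matrix ?\<psi> ** matrix \<phi>))"
    using trace_mul_sym[of "matrix \<phi>" "matrix f ** matrix ?\<psi>"] by (simp add: matrix_mul_assoc)
  also have "matrix ?\<psi> ** matrix \<phi> = mat 1"
  proof -
    have "?\<psi> \<circ> \<phi> = id" using \<phi>(2) by (simp add: bij_is_inj)
    then show ?thesis using matrix_compose_gen[OF lin(3) \<psi>]
      by (simp add: matrix_id_mat_1[unfolded id_def] id_def)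
  qed
  finally show ?thesis by (simp add: tr)
qed

primrec product_power :: "product \<Rightarrow> V \<Rightarrow> nat \<Rightarrow> V" where
  "product_power d x 0 = x"
| "product_power d x (Suc n) = d x (product_power d x n)"

lemma isomorphic_productsE:
  assumes "isomorphic_products d d'" "cbilinear d" "cbilinear d'"
  obtains \<phi> where "clinear \<phi>" "bij \<phi>" "\<And>x y. \<phi> (d x y) = d' (\<phi> x) (\<phi> y)"
    "\<And>x. left_trace d' (\<phi> x) = left_trace d x" "\<And>x. right_trace d' (\<phi> x) = right_trace d x"
    "\<And>x n. product_power d' (\<phi> x) n = \<phi> (product_power d x n)"
proof -
  obtain \<phi> where \<phi>: "clinear \<phi>" "bij \<phi>" and hom: "\<And>x y. \<phi> (d x y) = d' (\<phi> x) (\<phi> y)"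
    using assms(1) by (auto simp: isomorphic_products_def)
  have "left_trace d' (\<phi> x) = left_trace d x" for x
    unfolding left_trace_def
    by (rule sym, rule trace_conjugate[OF _ _ \<phi>]) (use assms hom in \<open>auto simp: cbilinear_def\<close>)
  moreover have "right_trace d' (\<phi> x) = right_trace d x" for x
    unfolding right_trace_def
    by (rule sym, rule trace_conjugate[OF _ _ \<phi>]) (use assms hom in \<open>auto simp: cbilinear_def\<close>)
  moreover have "product_power d' (\<phi> x) n = \<phi> (product_power d x n)" for x n
    by (induction n) (simp_all add: hom)
  ultimately show ?thesis using that \<phi> hom by blast
qed

text \<open>A relation takes the two sequences of traces of \<open>L\<close> and \<open>R\<close> at \<open>x, x\<^sup>2, x\<^sup>3, \<dots>\<close>; the entry with index
\<open>n\<close> belongs to the power \<open>n + 1\<close>. In an associative algebra \<open>L\<close> at a power of \<open>x\<close> is a power of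
\<open>L\<^sub>x\<close>, so the entries are the power sums of the eigenvalues of \<open>L\<^sub>x\<close> and \<open>R\<^sub>x\<close>.\<close>
type_synonym relation = "(nat \<Rightarrow> complex) \<Rightarrow> (nat \<Rightarrow> complex) \<Rightarrow> complex"

definition satisfies :: "product \<Rightarrow> relation \<Rightarrow> bool" where
  "satisfies d f \<longleftrightarrow>
    (\<forall>x. f (\<lambda>n. left_trace d (product_power d x n)) (\<lambda>n. right_trace d (product_power d x n)) = 0)"

lemma satisfies_isomorphic:
  assumes "isomorphic_products d d'" "cbilinear d" "cbilinear d'"
  shows "satisfies d f \<longleftrightarrow> satisfies d' f"
proof -
  obtain \<phi> where "bij \<phi>" and
    eq: "\<And>x. left_trace d' (\<phi> x) = left_trace d x" "\<And>x. right_trace d' (\<phi> x) = right_trace d x"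
    "\<And>x n. product_power d' (\<phi> x) n = \<phi> (product_power d x n)"
    using isomorphic_productsE[OF assms] by metis
  then have "(\<forall>x. P (\<phi> x)) \<longleftrightarrow> (\<forall>x. P x)" for P
    by (metis bij_pointE)
  from this[of "\<lambda>x. f (\<lambda>n. left_trace d' (product_power d' x n)) (\<lambda>n. right_trace d' (product_power d' x n)) = 0"]
  show ?thesis
    unfolding satisfies_def by (simp add: eq)
qed

lemma tendsto_product:
  fixes D :: "'a \<Rightarrow> product"
  assumes "\<And>t. cbilinear (D t)" "cbilinear d" "\<And>x y. ((\<lambda>t. D t x y) \<longlongrightarrow> d x y) F"
    and "(X \<longlongrightarrow> x) F" "(Y \<longlongrightarrow> y) F"
  shows "((\<lambda>t. D t (X t) (Y t)) \<longlongrightarrow> d x y) F"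
proof -
  have "((\<lambda>t. \<Sum>i\<in>UNIV. \<Sum>j\<in>UNIV. (X t $ i * Y t $ j) *s D t (axis i 1) (axis j 1)) \<longlongrightarrow>
    (\<Sum>i\<in>UNIV. \<Sum>j\<in>UNIV. (x $ i * y $ j) *s d (axis i 1) (axis j 1))) F"
    unfolding vector_scalar_mult_def
    by (intro tendsto_sum tendsto_vec_lambda tendsto_mult tendsto_vec_nth assms)
  with assms(1,2) show ?thesis
    by (simp flip: cbilinear_expand)
qed

text \<open>Every polynomial in finitely many of the traces has this property. All that is used of a
polynomial is that it respects limits of its arguments.\<close>
definition trace_continuous :: "relation \<Rightarrow> bool" where
  "trace_continuous f \<longleftrightarrow> (\<forall>L R l r (F :: complex filter).
     (\<forall>n. ((\<lambda>t. L t n) \<longlongrightarrow> l n) F) \<longrightarrow> (\<forall>n. ((\<lambda>t. R t n) \<longlongrightarrow> r n) F) \<longrightarrow>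
     ((\<lambda>t. f (L t) (R t)) \<longlongrightarrow> f l r) F)"

text \<open>Outside the disc on which the deformation is given, \<open>D\<close> takes the value \<open>d\<close>, so that it is bilinear everywhere; only
its germ at \<open>0\<close> matters.\<close>
lemma jump_family:
  assumes "jump_deformation d d'"
  obtains D :: "complex \<Rightarrow> product" where
    "\<And>t. cbilinear (D t)" "cbilinear d" "\<And>x y. ((\<lambda>t. D t x y) \<longlongrightarrow> d x y) (at 0)"
    "\<forall>\<^sub>F t in at 0. isomorphic_products (D t) d'"
proof -
  obtain \<psi> \<epsilon> where \<psi>: "\<forall>n. cbilinear (\<psi> n)" "\<psi> 0 = d" and \<epsilon>: "\<epsilon> > 0"
    and family: "\<forall>t. norm t < \<epsilon> \<longrightarrow>
           (\<forall>x y. summable (\<lambda>n. t ^ n *s \<psi> n x y)) \<and>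
           associative_product (power_series_product \<psi> t) \<and>
           (t \<noteq> 0 \<longrightarrow> isomorphic_products (power_series_product \<psi> t) d')"
    using assms unfolding jump_deformation_def by (elim conjE exE) (rule that; assumption)
  have summable: "summable (\<lambda>n. t ^ n *s \<psi> n x y)"
    and assoc: "associative_product (power_series_product \<psi> t)"
    and iso: "t \<noteq> 0 \<Longrightarrow> isomorphic_products (power_series_product \<psi> t) d'"
    if "norm t < \<epsilon>" for t x y
    using family that by simp_all
  let ?P = "power_series_product \<psi>"
  define D where "D t = (if norm t < \<epsilon> then ?P t else d)" for t
  have near: "\<forall>\<^sub>F t in at (0::complex). norm t < \<epsilon> \<and> t \<noteq> 0"
    using \<epsilon> by (auto simp: eventually_at intro!: exI[of _ \<epsilon>])
  have "cbilinear (D t)" for t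
    using assoc \<psi> by (auto simp: D_def associative_product_def)
  moreover have "cbilinear d" using \<psi> by metis
  moreover have "((\<lambda>t. D t x y) \<longlongrightarrow> d x y) (at 0)" for x y
  proof (rule Lim_transform_eventually)
    show "\<forall>\<^sub>F t in at 0. ?P t x y = D t x y"
      using near by eventually_elim (simp add: D_def)
    have "((\<lambda>t. ?P t x y $ i) \<longlongrightarrow> \<psi> 0 x y $ i) (at 0)" for i
    proof (rule powser_limit_0[OF \<epsilon>])
      fix t :: complex assume "norm t < \<epsilon>"
      from bounded_linear.sums[OF bounded_linear_vec_nth summable_sums[OF summable[OF this]]]
      show "(\<lambda>n. \<psi> n x y $ i * t ^ n) sums (?P t x y $ i)"
        by (simp add: power_series_product_def mult.commute)
    qed
    then show "((\<lambda>t. ?P t x y) \<longlongrightarrow> d x y) (at 0)"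
      using \<psi>(2) by (auto intro: vec_tendstoI)
  qed
  moreover have "\<forall>\<^sub>F t in at 0. isomorphic_products (D t) d'"
    using near by eventually_elim (simp add: D_def iso)
  ultimately show ?thesis using that by blast
qed

text \<open>For fixed \<open>x\<close> the value of the relation is continuous in \<open>t\<close> at \<open>0\<close> and vanishes for \<open>t \<noteq> 0\<close>, because
there the product is isomorphic to \<open>d'\<close>.\<close>
lemma jump_deformation_satisfies:
  assumes jump: "jump_deformation d d'" and d': "cbilinear d'"
    and f: "trace_continuous f" "satisfies d' f"
  shows "satisfies d f"
proof -
  obtain D :: "complex \<Rightarrow> product" where D: "\<And>t. cbilinear (D t)" and d: "cbilinear d"
    and lim: "\<And>x y. ((\<lambda>t. D t x y) \<longlongrightarrow> d x y) (at 0)"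
    and iso: "\<forall>\<^sub>F t in at 0. isomorphic_products (D t) d'"
    using jump_family[OF jump] by metis
  note tendsto_D = tendsto_product[OF D d lim]
  have "f (\<lambda>n. left_trace d (product_power d x n)) (\<lambda>n. right_trace d (product_power d x n)) = 0" for x
  proof -
    let ?f = "\<lambda>e. f (\<lambda>n. left_trace e (product_power e x n)) (\<lambda>n. right_trace e (product_power e x n))"
    have pow: "((\<lambda>t. product_power (D t) x n) \<longlongrightarrow> product_power d x n) (at 0)" for n
      by (induction n) (auto intro: tendsto_D)
    have "((\<lambda>t. left_trace (D t) (product_power (D t) x n)) \<longlongrightarrow> left_trace d (product_power d x n)) (at 0)"
      "((\<lambda>t. right_trace (D t) (product_power (D t) x n)) \<longlongrightarrow> right_trace d (product_power d x n)) (at 0)" for n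
      unfolding left_trace_def right_trace_def
      by (intro tendsto_sum tendsto_vec_nth tendsto_D pow tendsto_const)+
    then have "((\<lambda>t. ?f (D t)) \<longlongrightarrow> ?f d) (at 0)"
      by (rule f(1)[unfolded trace_continuous_def, rule_format,
          of "\<lambda>t n. left_trace (D t) (product_power (D t) x n)" "\<lambda>n. left_trace d (product_power d x n)" "at 0"
            "\<lambda>t n. right_trace (D t) (product_power (D t) x n)" "\<lambda>n. right_trace d (product_power d x n)"])
    moreover have "\<forall>\<^sub>F t in at 0. ?f (D t) = 0"
      using iso by eventually_elim
        (use satisfies_isomorphic[OF _ D d'] f(2) in \<open>auto simp: satisfies_def\<close>)
    ultimately have "((\<lambda>t. 0) \<longlongrightarrow> ?f d) (at (0::complex))"
      by (rule Lim_transform_eventually)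
    then show ?thesis by (simp add: tendsto_const_iff)
  qed
  then show ?thesis by (simp add: satisfies_def)
qed

definition opposite :: "relation \<Rightarrow> relation" where
  "opposite f l r = f r l"

text \<open>By Newton's identities this is \<open>6 det L\<^sub>x\<close>.\<close>
definition singular :: relation where
  "singular l r = l 0 ^ 3 - 3 * l 0 * l 1 + 2 * l 2"

text \<open>The Hankel determinant of the power sums \<open>3, l 0, l 1, l 2, l 3\<close>, which is the discriminant of the
characteristic polynomial of \<open>L\<^sub>x\<close>: it vanishes when \<open>L\<^sub>x\<close> has a repeated eigenvalue.\<close>
definition degenerate :: relation where
  "degenerate l r = 3 * (l 1 * l 3 - l 2 ^ 2) - l 0 * (l 0 * l 3 - l 1 * l 2)
     + l 1 * (l 0 * l 2 - l 1 ^ 2)"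

text \<open>If \<open>L\<^sub>x\<close> has the eigenvalues \<open>a, b, b\<close> and \<open>R\<^sub>x\<close> the eigenvalues \<open>a, a, b\<close>, as in the algebra of
upper triangular matrices, then the traces determine \<open>3a = 2 r 0 - l 0\<close> and \<open>3b = 2 l 0 - r 0\<close>, and the
relation says that \<open>l 1 = a\<^sup>2 + 2b\<^sup>2\<close>.\<close>
definition triangular :: relation where
  "triangular l r = 9 * l 1 - (2 * r 0 - l 0) ^ 2 - 2 * (2 * l 0 - r 0) ^ 2"

definition proportional_traces :: "complex \<Rightarrow> relation" where
  "proportional_traces c l r = r 0 - c * l 0"

text \<open>This holds with \<open>m\<close> a natural number when \<open>L\<^sub>x\<close> has a single nonzero eigenvalue, of multiplicity \<open>m\<close>.\<close>
definition equal_spectrum :: "complex \<Rightarrow> relation" where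
  "equal_spectrum m l r = l 0 ^ 2 - m * l 1"

lemma trace_continuous_relations:
  "trace_continuous singular" "trace_continuous degenerate" "trace_continuous triangular"
  "trace_continuous (proportional_traces c)"
  unfolding trace_continuous_def singular_def degenerate_def triangular_def proportional_traces_def
  by (intro allI impI tendsto_intros; blast)+

lemma trace_continuous_opposite: "trace_continuous f \<Longrightarrow> trace_continuous (opposite f)"
  unfolding trace_continuous_def opposite_def by blast

section \<open>Traces in the listed algebras\<close>

lemma power_coordinate:
  assumes "\<And>x y. d x y $ i = x $ i * y $ i"
  shows "product_power d x n $ i = x $ i ^ Suc n"
  by (induction n) (simp_all add: assms)

lemma traces_d22: "left_trace (d22 p q) x = 0" "right_trace (d22 p q) x = 0"
  by (simp_all add: left_trace_def right_trace_def d22_def psi_nth sum_3 axis_def)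

lemmas product_defs = d1_def d2_def d3_def d4_def d5_def d6_def d7_def d8_def d9_def d10_def d11_def
  d12_def d13_def d14_def d15_def d16_def d17_def d18_def d19_def d20_def d21_def

text \<open>The coordinates that occur in the traces are algebra homomorphisms to \<open>\<complex>\<close>; this makes the traces
at the powers of \<open>x\<close> explicit.\<close>
lemma characters:
  "product_power d1 x n $ 1 = x $ 1 ^ Suc n"
  "product_power d2 x n $ 1 = x $ 1 ^ Suc n"
  "product_power d3 x n $ 1 = x $ 1 ^ Suc n"
  "product_power d4 x n $ 1 = x $ 1 ^ Suc n"
  "product_power d5 x n $ 1 = x $ 1 ^ Suc n"
  "product_power d6 x n $ 1 = x $ 1 ^ Suc n" "product_power d6 x n $ 3 = x $ 3 ^ Suc n"
  "product_power d7 x n $ 1 = x $ 1 ^ Suc n"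
  "product_power d8 x n $ 1 = x $ 1 ^ Suc n"
  "product_power d9 x n $ 1 = x $ 1 ^ Suc n"
  "product_power d10 x n $ 1 = x $ 1 ^ Suc n" "product_power d10 x n $ 3 = x $ 3 ^ Suc n"
  "product_power d11 x n $ 1 = x $ 1 ^ Suc n" "product_power d11 x n $ 2 = x $ 2 ^ Suc n"
  "product_power d12 x n $ 1 = x $ 1 ^ Suc n" "product_power d12 x n $ 2 = x $ 2 ^ Suc n"
  "product_power d13 x n $ 1 = x $ 1 ^ Suc n" "product_power d13 x n $ 2 = x $ 2 ^ Suc n"
  "product_power d14 x n $ i = x $ i ^ Suc n"
  "product_power d17 x n $ 1 = x $ 1 ^ Suc n"
  "product_power d18 x n $ 1 = x $ 1 ^ Suc n"
  "product_power d19 x n $ 3 = x $ 3 ^ Suc n"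
  "product_power d20 x n $ 1 = x $ 1 ^ Suc n"
  using exhaust_3[of i]
  by (auto intro!: power_coordinate simp del: power_Suc simp: product_defs psi_nth)

lemma left_traces:
  "left_trace d1 x = x $ 1" "left_trace d2 x = x $ 1" "left_trace d3 x = 2 * x $ 1"
  "left_trace d4 x = x $ 1" "left_trace d5 x = 2 * x $ 1" "left_trace d6 x = x $ 1 + x $ 3"
  "left_trace d7 x = 2 * x $ 1" "left_trace d8 x = x $ 1" "left_trace d9 x = 2 * x $ 1"
  "left_trace d10 x = x $ 1 + x $ 3" "left_trace d11 x = x $ 1 + 2 * x $ 2"
  "left_trace d12 x = x $ 1 + 2 * x $ 2" "left_trace d13 x = x $ 1 + 2 * x $ 2"
  "left_trace d14 x = x $ 1 + x $ 2 + x $ 3" "left_trace d15 x = 0" "left_trace d16 x = 0"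
  "left_trace d17 x = 3 * x $ 1" "left_trace d18 x = 3 * x $ 1" "left_trace d19 x = 3 * x $ 3"
  "left_trace d20 x = 3 * x $ 1" "left_trace d21 x = 0" "left_trace (d22 p q) x = 0"
  by (simp_all only: traces_d22)
    (simp_all add: product_defs
      left_trace_add left_trace_diff left_trace_psi)

lemma right_traces:
  "right_trace d1 x = x $ 1" "right_trace d2 x = x $ 1" "right_trace d3 x = x $ 1"
  "right_trace d4 x = 2 * x $ 1" "right_trace d5 x = 2 * x $ 1" "right_trace d6 x = x $ 1 + x $ 3"
  "right_trace d7 x = 2 * x $ 1" "right_trace d8 x = 3 * x $ 1" "right_trace d9 x = 3 * x $ 1"
  "right_trace d10 x = 2 * x $ 1 + x $ 3" "right_trace d11 x = x $ 1 + x $ 2"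
  "right_trace d12 x = x $ 1 + 2 * x $ 2" "right_trace d13 x = 2 * x $ 1 + x $ 2"
  "right_trace d14 x = x $ 1 + x $ 2 + x $ 3" "right_trace d15 x = 0" "right_trace d16 x = 0"
  "right_trace d17 x = 2 * x $ 1" "right_trace d18 x = 3 * x $ 1" "right_trace d19 x = 3 * x $ 3"
  "right_trace d20 x = x $ 1" "right_trace d21 x = 0" "right_trace (d22 p q) x = 0"
  by (simp_all only: traces_d22)
    (simp_all add: product_defs
      right_trace_add right_trace_diff right_trace_psi)

lemmas relation_simps = satisfies_def opposite_def singular_def degenerate_def triangular_def
  proportional_traces_def equal_spectrum_def

lemmas spectra = left_traces right_traces characters

lemma singular_listed:
  "d \<in> {d1, d2, d3, d4, d5, d6, d7, d8, d9, d10, d15, d16, d21, d22 p q} \<Longrightarrow> satisfies d singular"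
  "d \<in> {d1, d2, d3, d4, d5, d6, d7, d11, d15, d16, d17, d20, d21, d22 p q} \<Longrightarrow>
     satisfies d (opposite singular)"
  by (auto simp: relation_simps spectra eval_nat_numeral algebra_simps simp del: product_power.simps(2))

lemma degenerate_listed:
  "d \<in> {d1, d2, d3, d4, d5, d7, d8, d9, d11, d12, d13, d15, d16, d17, d18, d19, d20, d21, d22 p q}
     \<Longrightarrow> satisfies d degenerate"
  "satisfies d10 (opposite degenerate)"
  by (auto simp: relation_simps spectra eval_nat_numeral algebra_simps simp del: product_power.simps(2))

lemma triangular_listed:
  "d \<in> {d13, d18, d19} \<Longrightarrow> satisfies d triangular \<and> satisfies d (opposite triangular)"
  by (auto simp: relation_simps spectra eval_nat_numeral algebra_simps simp del: product_power.simps(2))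

lemma proportional_traces_listed:
  "d \<in> {d12, d14, d18, d19} \<Longrightarrow> satisfies d (proportional_traces 1)"
  "satisfies d8 (proportional_traces 3)"
  "satisfies d20 (opposite (proportional_traces 3))"
  by (auto simp: relation_simps spectra simp del: product_power.simps(2))

lemma equal_spectrum_listed:
  "d \<in> {d1, d2, d4} \<Longrightarrow> satisfies d (equal_spectrum 1)"
  "satisfies d3 (opposite (equal_spectrum 1))"
  "d \<in> {d5, d9} \<Longrightarrow> satisfies d (equal_spectrum 2)"
  "satisfies d17 (opposite (equal_spectrum 2))"
  "d \<in> {d18, d19} \<Longrightarrow> satisfies d (equal_spectrum 3)"
  by (auto simp: relation_simps spectra eval_nat_numeral algebra_simps simp del: product_power.simps(2))

section \<open>Excluded jump deformations\<close>

lemma cbilinear_listed: "d \<in> listed_products \<Longrightarrow> cbilinear d"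
proof -
  have "cbilinear (d22 p q)" for p q
    using cbilinear_add[OF cbilinear_scale[OF cbilinear_psi] cbilinear_scale[OF cbilinear_psi],
        of p 1 2 3 q 2 1 3]
    by (simp add: d22_def scale_def plus_fun_def)
  moreover have "cbilinear d21"
    by (auto simp: d21_def cbilinear_iff vec_eq_iff psi_nth algebra_simps)
  ultimately show "d \<in> listed_products \<Longrightarrow> cbilinear d"
    unfolding listed_products_def
    by (auto simp: product_defs
      intro!: cbilinear_add cbilinear_psi)
qed

lemma not_jump_deformation:
  assumes "d' \<in> listed_products" "satisfies d' f" "trace_continuous f" "\<not> satisfies d f"
  shows "\<not> jump_deformation d d'"
  using jump_deformation_satisfies[OF _ cbilinear_listed] assms by blast

lemma no_jump_deformation_to_itself: "\<not> jump_deformation d d"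
proof -
  have "clinear (\<lambda>x. x)" by (auto simp: clinear_def Vector_Spaces.linear_iff vec.vector_space_axioms)
  then have "isomorphic_products d d"
    unfolding isomorphic_products_def by (auto intro!: exI[of _ "\<lambda>x. x"] simp: bij_id[unfolded id_def])
  then show ?thesis by (simp add: jump_deformation_def)
qed

lemma not_satisfies:
  "f (\<lambda>n. left_trace d (product_power d x n)) (\<lambda>n. right_trace d (product_power d x n)) \<noteq> 0 \<Longrightarrow> \<not> satisfies d f"
  by (auto simp: satisfies_def)

lemma listed_cases:
  assumes "d \<in> listed_products"
  obtains p q where "d \<in> {d1, d2, d3, d4, d5, d6, d7, d8, d9, d10, d11, d12, d13, d14, d15, d16, d17,
    d18, d19, d20, d21, d22 p q}"
  using assms unfolding listed_products_def by blast

text \<open>Here \<open>L\<^sub>x\<close> and \<open>R\<^sub>x\<close> both have the eigenvalues \<open>x $ 1, x $ 3, 0\<close>, generically distinct. In the other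
listed algebras apart from \<open>d14\<close>, one of the two operators always has a repeated eigenvalue.\<close>
lemma jump_d6_only:
  assumes "d' \<in> listed_products" "jump_deformation d6 d'"
  shows "d' = d14"
proof -
  have "\<not> satisfies d6 degenerate" "\<not> satisfies d6 (opposite degenerate)"
    by (rule not_satisfies[where x = "vector [1, 0, 2]"],
        simp add: relation_simps spectra eval_nat_numeral del: product_power.simps(2))+
  then have "\<not> satisfies d' degenerate" "\<not> satisfies d' (opposite degenerate)"
    using not_jump_deformation assms trace_continuous_relations trace_continuous_opposite by blast+
  moreover have "d' \<noteq> d6" using assms(2) no_jump_deformation_to_itself by blast
  moreover obtain p q where "d' \<in> {d1, d2, d3, d4, d5, d6, d7, d8, d9, d10, d11, d12, d13, d14,
      d15, d16, d17, d18, d19, d20, d21, d22 p q}"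
    using assms(1) by (rule listed_cases)
  ultimately show ?thesis
    using degenerate_listed(1)[of d' p q] degenerate_listed(2)
    by auto
qed

text \<open>\<open>R\<close> is the identity at the first basis vector of \<open>d9\<close>, which leaves only the algebras in which some
\<open>R\<^sub>x\<close> is invertible. Among these, apart from \<open>d9\<close> and \<open>d10\<close>, the commutative ones have equal
left and right traces, in \<open>d8\<close> the right trace is three times the left one, and \<open>d13\<close> is triangular; \<open>d9\<close>, with traces \<open>2\<close> and \<open>3\<close> at that vector,
is none of this.\<close>
lemma jump_d9_only:
  assumes "d' \<in> listed_products" "jump_deformation d9 d'"
  shows "d' = d10"
proof -
  have "\<not> satisfies d9 (opposite singular)" "\<not> satisfies d9 (proportional_traces 1)"
    "\<not> satisfies d9 (proportional_traces 3)" "\<not> satisfies d9 (opposite triangular)"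
    by (rule not_satisfies[where x = "vector [1, 0, 0]"],
        simp add: relation_simps spectra eval_nat_numeral del: product_power.simps(2))+
  then have "\<not> satisfies d' (opposite singular)" "\<not> satisfies d' (proportional_traces 1)"
    "\<not> satisfies d' (proportional_traces 3)" "\<not> satisfies d' (opposite triangular)"
    using not_jump_deformation assms trace_continuous_relations trace_continuous_opposite by blast+
  moreover have "d' \<noteq> d9" using assms(2) no_jump_deformation_to_itself by blast
  moreover obtain p q where "d' \<in> {d1, d2, d3, d4, d5, d6, d7, d8, d9, d10, d11, d12, d13, d14,
      d15, d16, d17, d18, d19, d20, d21, d22 p q}"
    using assms(1) by (rule listed_cases)
  ultimately show ?thesis
    using singular_listed(2)[of d' p q] triangular_listed[of d']
      proportional_traces_listed(1)[of d'] proportional_traces_listed(2,3)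
    by auto
qed

text \<open>\<open>d12\<close> has a unit, which leaves only the unital algebras. Apart from \<open>d12\<close> and \<open>d14\<close> these are
\<open>d13\<close>, \<open>d18\<close> and \<open>d19\<close>, all of which satisfy the triangular relation; for \<open>d18\<close> and \<open>d19\<close> this is
the case \<open>a = b\<close>.\<close>
lemma jump_d12_only:
  assumes "d' \<in> listed_products" "jump_deformation d12 d'"
  shows "d' = d14"
proof -
  have "\<not> satisfies d12 singular" "\<not> satisfies d12 (opposite singular)"
    by (rule not_satisfies[where x = "vector [1, 1, 0]"],
        simp add: relation_simps spectra eval_nat_numeral del: product_power.simps(2))+
  moreover have "\<not> satisfies d12 triangular"
    by (rule not_satisfies[where x = "vector [1, 0, 0]"],
        simp add: relation_simps spectra eval_nat_numeral del: product_power.simps(2))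
  ultimately have "\<not> satisfies d' singular" "\<not> satisfies d' (opposite singular)"
    "\<not> satisfies d' triangular"
    using not_jump_deformation assms trace_continuous_relations trace_continuous_opposite by blast+
  moreover have "d' \<noteq> d12" using assms(2) no_jump_deformation_to_itself by blast
  moreover obtain p q where "d' \<in> {d1, d2, d3, d4, d5, d6, d7, d8, d9, d10, d11, d12, d13, d14,
      d15, d16, d17, d18, d19, d20, d21, d22 p q}"
    using assms(1) by (rule listed_cases)
  ultimately show ?thesis
    using singular_listed[of d' p q] triangular_listed[of d']
    by auto
qed

text \<open>\<open>d17\<close> is isomorphic to the opposite algebra of \<open>d9\<close>, and the argument is the mirror image, with \<open>d20\<close>
in place of \<open>d8\<close>.\<close>
lemma jump_d17_only:
  assumes "d' \<in> listed_products" "jump_deformation d17 d'"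
  shows "d' = d11"
proof -
  have "\<not> satisfies d17 singular" "\<not> satisfies d17 (proportional_traces 1)"
    "\<not> satisfies d17 (opposite (proportional_traces 3))" "\<not> satisfies d17 triangular"
    by (rule not_satisfies[where x = "vector [1, 0, 0]"],
        simp add: relation_simps spectra eval_nat_numeral del: product_power.simps(2))+
  then have "\<not> satisfies d' singular" "\<not> satisfies d' (proportional_traces 1)"
    "\<not> satisfies d' (opposite (proportional_traces 3))" "\<not> satisfies d' triangular"
    using not_jump_deformation assms trace_continuous_relations trace_continuous_opposite by blast+
  moreover have "d' \<noteq> d17" using assms(2) no_jump_deformation_to_itself by blast
  moreover obtain p q where "d' \<in> {d1, d2, d3, d4, d5, d6, d7, d8, d9, d10, d11, d12, d13, d14,
      d15, d16, d17, d18, d19, d20, d21, d22 p q}"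
    using assms(1) by (rule listed_cases)
  ultimately show ?thesis
    using singular_listed(1)[of d' p q] triangular_listed[of d']
      proportional_traces_listed(1)[of d'] proportional_traces_listed(2,3)
    by auto
qed

section \<open>Pairs of non-isomorphic algebras\<close>

lemma not_isomorphic_satisfies:
  assumes "d \<in> listed_products" "d' \<in> listed_products" "satisfies d f"
    "f (\<lambda>n. left_trace d' (product_power d' x n)) (\<lambda>n. right_trace d' (product_power d' x n)) \<noteq> 0"
  shows "\<not> isomorphic_products d d'"
  using satisfies_isomorphic[OF _ cbilinear_listed cbilinear_listed] not_satisfies assms by blast

text \<open>Needed for pairs with the same traces: in \<open>d1\<close> and \<open>d18\<close> the elements of trace zero have square
zero, in \<open>d2\<close> and \<open>d19\<close> one of them has not.\<close>
lemma not_isomorphic_traceless_square: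
  assumes "d \<in> listed_products" "d' \<in> listed_products"
    and "\<And>x. left_trace d x = 0 \<Longrightarrow> d x x = 0" and y: "left_trace d' y = 0" "d' y y \<noteq> 0"
  shows "\<not> isomorphic_products d d'"
proof
  assume "isomorphic_products d d'"
  then obtain \<phi> where \<phi>: "clinear \<phi>" "bij \<phi>" "\<And>x y. \<phi> (d x y) = d' (\<phi> x) (\<phi> y)"
    "\<And>x. left_trace d' (\<phi> x) = left_trace d x"
    using isomorphic_productsE assms(1,2) cbilinear_listed by metis
  obtain x where "y = \<phi> x" using \<phi>(2) by (metis bij_pointE)
  moreover have "\<phi> 0 = 0"
    using \<phi>(1) vec.linear_0 by (auto simp: clinear_def)
  ultimately show False using \<phi> assms by metis
qed

lemma products_listed [simp]:
  "d1 \<in> listed_products" "d2 \<in> listed_products" "d3 \<in> listed_products" "d4 \<in> listed_products"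
  "d5 \<in> listed_products" "d6 \<in> listed_products" "d9 \<in> listed_products" "d10 \<in> listed_products"
  "d11 \<in> listed_products" "d12 \<in> listed_products" "d13 \<in> listed_products" "d14 \<in> listed_products"
  "d16 \<in> listed_products" "d17 \<in> listed_products" "d18 \<in> listed_products" "d19 \<in> listed_products"
  by (simp_all add: listed_products_def)

lemma not_isomorphic_d1_d2: "\<not> isomorphic_products d1 d2"
  by (rule not_isomorphic_traceless_square[where y = "axis 2 1"])
    (auto simp: left_traces, auto simp: d1_def d2_def vec_eq_iff psi_nth forall_3 axis_def)

lemma not_isomorphic_d18_d19: "\<not> isomorphic_products d18 d19"
  by (rule not_isomorphic_traceless_square[where y = "axis 1 1"])
    (auto simp: left_traces, auto simp: d18_def d19_def vec_eq_iff psi_nth forall_3 axis_def)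

lemma not_isomorphic_d1:
  "d' \<in> {d6, d10, d11, d12, d14} \<Longrightarrow> \<not> isomorphic_products d1 d'"
  by (rule not_isomorphic_satisfies[where f = "equal_spectrum 1" and x = "vector [1, 1, 1]"])
    (auto simp: equal_spectrum_listed, auto simp: relation_simps spectra simp del: product_power.simps(2))

lemma not_isomorphic_d2:
  "d' \<in> {d6, d12, d14} \<Longrightarrow> \<not> isomorphic_products d2 d'"
  by (rule not_isomorphic_satisfies[where f = "equal_spectrum 1" and x = "vector [1, 1, 1]"])
    (auto simp: equal_spectrum_listed, auto simp: relation_simps spectra simp del: product_power.simps(2))

lemma not_isomorphic_d3:
  "d' \<in> {d11, d13} \<Longrightarrow> \<not> isomorphic_products d3 d'"
  by (rule not_isomorphic_satisfies[where f = "opposite (equal_spectrum 1)" and x = "vector [1, 1, 1]"])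
    (auto simp: equal_spectrum_listed, auto simp: relation_simps spectra simp del: product_power.simps(2))

lemma not_isomorphic_d4:
  "d' \<in> {d10, d13} \<Longrightarrow> \<not> isomorphic_products d4 d'"
  by (rule not_isomorphic_satisfies[where f = "equal_spectrum 1" and x = "vector [1, 1, 1]"])
    (auto simp: equal_spectrum_listed, auto simp: relation_simps spectra simp del: product_power.simps(2))

lemma not_isomorphic_d5:
  "d' \<in> {d6, d12, d14} \<Longrightarrow> \<not> isomorphic_products d5 d'"
  by (rule not_isomorphic_satisfies[where f = "equal_spectrum 2" and x = "vector [1, 0, 0]"])
    (auto simp: equal_spectrum_listed, auto simp: relation_simps spectra simp del: product_power.simps(2))

lemma not_isomorphic_d6: "\<not> isomorphic_products d6 d14"
  by (rule not_isomorphic_satisfies[where f = singular and x = "vector [1, 1, 1]"])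
    (auto simp: singular_listed, auto simp: relation_simps spectra simp del: product_power.simps(2))

lemma not_isomorphic_d9: "\<not> isomorphic_products d9 d10"
  by (rule not_isomorphic_satisfies[where f = "equal_spectrum 2" and x = "vector [1, 0, 0]"])
    (auto simp: equal_spectrum_listed, auto simp: relation_simps spectra simp del: product_power.simps(2))

lemma not_isomorphic_d12: "\<not> isomorphic_products d12 d14"
  by (rule not_isomorphic_satisfies[where f = degenerate and x = "vector [1, 2, 0]"])
    (auto simp: degenerate_listed, auto simp: relation_simps spectra eval_nat_numeral simp del: product_power.simps(2))

text \<open>\<open>d16\<close> is nilpotent, so all its traces vanish.\<close>
lemma not_isomorphic_d16:
  "d' \<in> {d2, d5, d6, d12, d14, d19} \<Longrightarrow> \<not> isomorphic_products d16 d'"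
  by (rule not_isomorphic_satisfies[where f = "\<lambda>l r. l 0" and x = "vector [1, 1, 1]"])
    (auto simp: satisfies_def left_traces)

lemma not_isomorphic_d17: "\<not> isomorphic_products d17 d11"
  by (rule not_isomorphic_satisfies[where f = "opposite (equal_spectrum 2)" and x = "vector [1, 0, 0]"])
    (auto simp: equal_spectrum_listed, auto simp: relation_simps spectra simp del: product_power.simps(2))

lemma not_isomorphic_d18:
  "d' \<in> {d12, d13, d14} \<Longrightarrow> \<not> isomorphic_products d18 d'"
  by (rule not_isomorphic_satisfies[where f = "equal_spectrum 3" and x = "vector [1, 0, 0]"])
    (auto simp: equal_spectrum_listed, auto simp: relation_simps spectra simp del: product_power.simps(2))

lemma not_isomorphic_d19:
  "d' \<in> {d12, d14} \<Longrightarrow> \<not> isomorphic_products d19 d'"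
  by (rule not_isomorphic_satisfies[where f = "equal_spectrum 3" and x = "vector [1, 0, 0]"])
    (auto simp: equal_spectrum_listed, auto simp: relation_simps spectra simp del: product_power.simps(2))

section \<open>The jump deformations\<close>

text \<open>The algebra \<open>d16\<close> is \<open>x\<complex>[x]/(x\<^sup>4)\<close>. It deforms to \<open>x\<complex>[x]/(x p(x))\<close> where \<open>p\<close> has the roots
\<open>ta, tb, tc\<close>. In the Newton basis \<open>x, x(x - ta), x(x - ta)(x - tb)\<close> the multiplication by \<open>x\<close> sends each
basis vector to the next one (the last one to \<open>0\<close>) plus, respectively, \<open>ta\<close>, \<open>tb\<close> or \<open>tc\<close> times itself;
the entries below are the coefficients of \<open>t, t\<^sup>2, t\<^sup>3\<close> in the resulting structure constants.\<close>
definition newton :: "complex \<Rightarrow> complex \<Rightarrow> complex \<Rightarrow> product list" where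
  "newton a b c =
    [scale a (psi 1 1 1) + scale b (psi 1 2 2 + psi 2 1 2)
       + scale c (psi 1 3 3 + psi 3 1 3) + scale (b + c - a) (psi 2 2 3),
     scale (b * (b - a)) (psi 2 2 2) + scale (c * (c - a)) (psi 2 3 3 + psi 3 2 3),
     scale (c * (c - a) * (c - b)) (psi 3 3 3)]"

lemma cbilinear_newton: "e \<in> set (newton a b c) \<Longrightarrow> cbilinear e"
  unfolding newton_def by (auto intro!: cbilinear_add cbilinear_scale cbilinear_psi)

lemmas coordinates = newton_def scale_def basis_map_def psi_nth vec_eq_iff forall_3
  algebra_simps power2_eq_square power3_eq_cube

text \<open>\<open>d1\<close> is the sum of \<open>\<complex>\<close> and a plane with zero product. The zero product deforms to \<open>t \<mu>\<close> for every
associative product \<open>\<mu>\<close> on the plane, and scaling by \<open>t\<close> identifies \<open>t \<mu>\<close> with \<open>\<mu>\<close>. The targets are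
the sums of \<open>\<complex>\<close> and some algebra \<open>\<mu>\<close>; in \<open>d10\<close> it is the third basis vector that spans \<open>\<complex>\<close>.\<close>
lemma jump_d1_d2: "jump_deformation d1 d2"
  by (rule jump_deformationI[where bs = "[psi 2 2 3]"
        and u = "\<lambda>t. vector [1, 0, 0]" and v = "\<lambda>t. vector [0, t, 0]" and w = "\<lambda>t. vector [0, 0, t]"])
    (auto simp: not_isomorphic_d1_d2 associative_listed cbilinear_newton
       intro!: cbilinear_add cbilinear_scale cbilinear_psi,
     auto simp: d1_def d2_def coordinates)

lemma jump_d1_d6: "jump_deformation d1 d6"
  by (rule jump_deformationI[where bs = "[psi 3 3 3]"
        and u = "\<lambda>t. vector [1, 0, 0]" and v = "\<lambda>t. vector [0, t, 0]" and w = "\<lambda>t. vector [0, 0, t]"])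
    (auto simp: not_isomorphic_d1[of d6] associative_listed cbilinear_newton
       intro!: cbilinear_add cbilinear_scale cbilinear_psi,
     auto simp: d1_def d6_def coordinates)

lemma jump_d1_d10: "jump_deformation d1 d10"
  by (rule jump_deformationI[where bs = "[psi 3 3 3 + psi 2 3 2]"
        and u = "\<lambda>t. vector [0, 0, 1]" and v = "\<lambda>t. vector [0, t, 0]" and w = "\<lambda>t. vector [t, 0, 0]"])
    (auto simp: not_isomorphic_d1[of d10] associative_listed cbilinear_newton
       intro!: cbilinear_add cbilinear_scale cbilinear_psi,
     auto simp: d1_def d10_def coordinates)

lemma jump_d1_d11: "jump_deformation d1 d11"
  by (rule jump_deformationI[where bs = "[psi 2 2 2 + psi 2 3 3]"
        and u = "\<lambda>t. vector [1, 0, 0]" and v = "\<lambda>t. vector [0, t, 0]" and w = "\<lambda>t. vector [0, 0, t]"])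
    (auto simp: not_isomorphic_d1[of d11] associative_listed cbilinear_newton
       intro!: cbilinear_add cbilinear_scale cbilinear_psi,
     auto simp: d1_def d11_def coordinates)

lemma jump_d1_d12: "jump_deformation d1 d12"
  by (rule jump_deformationI[where bs = "[psi 2 2 2 + psi 2 3 3 + psi 3 2 3]"
        and u = "\<lambda>t. vector [1, 0, 0]" and v = "\<lambda>t. vector [0, t, 0]" and w = "\<lambda>t. vector [0, 0, t]"])
    (auto simp: not_isomorphic_d1[of d12] associative_listed cbilinear_newton
       intro!: cbilinear_add cbilinear_scale cbilinear_psi,
     auto simp: d1_def d12_def coordinates)

lemma jump_d1_d14: "jump_deformation d1 d14"
  by (rule jump_deformationI[where bs = "[psi 2 2 2 + psi 3 3 3]"
        and u = "\<lambda>t. vector [1, 0, 0]" and v = "\<lambda>t. vector [0, t, 0]" and w = "\<lambda>t. vector [0, 0, t]"])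
    (auto simp: not_isomorphic_d1[of d14] associative_listed cbilinear_newton
       intro!: cbilinear_add cbilinear_scale cbilinear_psi,
     auto simp: d1_def d14_def coordinates)

text \<open>\<open>d2\<close> is the sum of \<open>\<complex>\<close> and \<open>x\<complex>[x]/(x\<^sup>3)\<close>. The modulus deforms to \<open>x\<^sup>2(x - t)\<close> here, to
\<open>x(x - t)\<^sup>2\<close> for \<open>d12\<close> and to \<open>x(x - t)(x - 2t)\<close> for \<open>d14\<close>, in the basis \<open>x, x(x - t)\<close>.\<close>
lemma jump_d2_d6: "jump_deformation d2 d6"
  by (rule jump_deformationI[where bs = "[psi 2 2 2]"
        and u = "\<lambda>t. vector [1, 0, 0]" and v = "\<lambda>t. vector [0, 1, t]" and w = "\<lambda>t. vector [0, - t, 0]"])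
    (auto simp: not_isomorphic_d2[of d6] associative_listed cbilinear_newton
       intro!: cbilinear_add cbilinear_scale cbilinear_psi,
     auto simp: d2_def d6_def coordinates)

lemma jump_d2_d12: "jump_deformation d2 d12"
  by (rule jump_deformationI[where bs = "[psi 2 2 2 + psi 2 3 3 + psi 3 2 3]"
        and u = "\<lambda>t. vector [1, 0, 0]" and v = "\<lambda>t. vector [0, t, 1]" and w = "\<lambda>t. vector [0, 0, t]"])
    (auto simp: not_isomorphic_d2[of d12] associative_listed cbilinear_newton
       intro!: cbilinear_add cbilinear_scale cbilinear_psi,
     auto simp: d2_def d12_def coordinates)

lemma jump_d2_d14: "jump_deformation d2 d14"
  by (rule jump_deformationI[where bs = "[psi 2 2 2 + scale 2 (psi 2 3 3 + psi 3 2 3), scale 2 (psi 3 3 3)]"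
        and u = "\<lambda>t. vector [1, 0, 0]" and v = "\<lambda>t. vector [0, t, 2 * t]" and w = "\<lambda>t. vector [0, 0, 2 * t^2]"])
    (auto simp: not_isomorphic_d2[of d14] associative_listed cbilinear_newton
       intro!: cbilinear_add cbilinear_scale cbilinear_psi,
     auto simp: d2_def d14_def coordinates)

text \<open>In \<open>d3\<close> and \<open>d4\<close> the second basis vector spans a null summand. Setting its square to \<open>t\<close> times itself
makes it \<open>t\<close> times a new idempotent, which in the case of \<open>d13\<close> also acts on the third basis vector,
from the side where the old idempotent acts by zero.\<close>
lemma jump_d3_d11: "jump_deformation d3 d11"
  by (rule jump_deformationI[where bs = "[psi 2 2 2]"
        and u = "\<lambda>t. vector [0, 1, 0]" and v = "\<lambda>t. vector [t, 0, 0]" and w = "\<lambda>t. vector [0, 0, 1]"])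
    (auto simp: not_isomorphic_d3[of d11] associative_listed cbilinear_newton
       intro!: cbilinear_add cbilinear_scale cbilinear_psi,
     auto simp: d3_def d11_def coordinates)

lemma jump_d3_d13: "jump_deformation d3 d13"
  by (rule jump_deformationI[where bs = "[psi 2 2 2 + psi 3 2 3]"
        and u = "\<lambda>t. vector [0, 1, 0]" and v = "\<lambda>t. vector [t, 0, 0]" and w = "\<lambda>t. vector [0, 0, 1]"])
    (auto simp: not_isomorphic_d3[of d13] associative_listed cbilinear_newton
       intro!: cbilinear_add cbilinear_scale cbilinear_psi,
     auto simp: d3_def d13_def coordinates)

lemma jump_d4_d10: "jump_deformation d4 d10"
  by (rule jump_deformationI[where bs = "[psi 2 2 2]"
        and u = "\<lambda>t. vector [1, 0, 0]" and v = "\<lambda>t. vector [0, 0, t]" and w = "\<lambda>t. vector [0, 1, 0]"])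
    (auto simp: not_isomorphic_d4[of d10] associative_listed cbilinear_newton
       intro!: cbilinear_add cbilinear_scale cbilinear_psi,
     auto simp: d4_def d10_def coordinates)

lemma jump_d4_d13: "jump_deformation d4 d13"
  by (rule jump_deformationI[where bs = "[psi 2 2 2 + psi 2 3 3]"
        and u = "\<lambda>t. vector [1, 0, 0]" and v = "\<lambda>t. vector [0, t, 0]" and w = "\<lambda>t. vector [0, 0, 1]"])
    (auto simp: not_isomorphic_d4[of d13] associative_listed cbilinear_newton
       intro!: cbilinear_add cbilinear_scale cbilinear_psi,
     auto simp: d4_def d13_def coordinates)

text \<open>\<open>d5\<close> is the sum of the dual numbers and a null line. The nilpotent of the dual numbers, or the vector on
the line, or both acquire the square \<open>t\<close> times themselves.\<close>
lemma jump_d5_d6: "jump_deformation d5 d6"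
  by (rule jump_deformationI[where bs = "[psi 3 3 3]"
        and u = "\<lambda>t. vector [1, 0, 1]" and v = "\<lambda>t. vector [0, 1, 0]" and w = "\<lambda>t. vector [0, 0, t]"])
    (auto simp: not_isomorphic_d5[of d6] associative_listed cbilinear_newton
       intro!: cbilinear_add cbilinear_scale cbilinear_psi,
     auto simp: d5_def d6_def coordinates)

lemma jump_d5_d12: "jump_deformation d5 d12"
  by (rule jump_deformationI[where bs = "[psi 2 2 2]"
        and u = "\<lambda>t. vector [0, 1, 0]" and v = "\<lambda>t. vector [t, 0, 0]" and w = "\<lambda>t. vector [0, 0, 1]"])
    (auto simp: not_isomorphic_d5[of d12] associative_listed cbilinear_newton
       intro!: cbilinear_add cbilinear_scale cbilinear_psi,
     auto simp: d5_def d12_def coordinates)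

lemma jump_d5_d14: "jump_deformation d5 d14"
  by (rule jump_deformationI[where bs = "[psi 2 2 2 + psi 3 3 3]"
        and u = "\<lambda>t. vector [1, 0, 1]" and v = "\<lambda>t. vector [0, t, 0]" and w = "\<lambda>t. vector [0, 0, t]"])
    (auto simp: not_isomorphic_d5[of d14] associative_listed cbilinear_newton
       intro!: cbilinear_add cbilinear_scale cbilinear_psi,
     auto simp: d5_def d14_def coordinates)

text \<open>Again a vector of square zero becomes \<open>t\<close> times an idempotent, here and from \<open>d9\<close> and \<open>d12\<close>.\<close>
lemma jump_d6_d14: "jump_deformation d6 d14"
  by (rule jump_deformationI[where bs = "[psi 2 2 2]"
        and u = "\<lambda>t. vector [1, 0, 0]" and v = "\<lambda>t. vector [0, t, 0]" and w = "\<lambda>t. vector [0, 0, 1]"])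
    (auto simp: not_isomorphic_d6 associative_listed cbilinear_newton
       intro!: cbilinear_add cbilinear_scale cbilinear_psi,
     auto simp: d6_def d14_def coordinates)

lemma jump_d9_d10: "jump_deformation d9 d10"
  by (rule jump_deformationI[where bs = "[psi 3 3 3]"
        and u = "\<lambda>t. vector [1, 0, 1]" and v = "\<lambda>t. vector [0, 1, 0]" and w = "\<lambda>t. vector [0, 0, t]"])
    (auto simp: not_isomorphic_d9 associative_listed cbilinear_newton
       intro!: cbilinear_add cbilinear_scale cbilinear_psi,
     auto simp: d9_def d10_def coordinates)

lemma jump_d12_d14: "jump_deformation d12 d14"
  by (rule jump_deformationI[where bs = "[psi 3 3 3]"
        and u = "\<lambda>t. vector [1, 0, 0]" and v = "\<lambda>t. vector [0, 1, 1]" and w = "\<lambda>t. vector [0, 0, t]"])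
    (auto simp: not_isomorphic_d12 associative_listed cbilinear_newton
       intro!: cbilinear_add cbilinear_scale cbilinear_psi,
     auto simp: d12_def d14_def coordinates)

text \<open>The six targets of \<open>d16\<close> correspond to the ways in which the roots of \<open>p\<close> can coincide with each other or
with \<open>0\<close>, not all of them being \<open>0\<close>. The images of the Newton basis are found by
evaluating at the roots, with Taylor coefficients at a repeated root.\<close>
lemma jump_d16_d2: "jump_deformation d16 d2"
  by (rule jump_deformationI[where bs = "newton 1 0 0"
        and u = "\<lambda>t. vector [t, 1, 0]" and v = "\<lambda>t. vector [0, - t, 1]" and w = "\<lambda>t. vector [0, 0, - t]"])
    (auto simp: not_isomorphic_d16[of d2] associative_listed cbilinear_newton
       intro!: cbilinear_add cbilinear_scale cbilinear_psi,
     auto simp: d16_def d2_def coordinates)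

lemma jump_d16_d5: "jump_deformation d16 d5"
  by (rule jump_deformationI[where bs = "newton 1 1 0"
        and u = "\<lambda>t. vector [t, 1, 1]" and v = "\<lambda>t. vector [0, - t, t]" and w = "\<lambda>t. vector [0, t^2, 0]"])
    (auto simp: not_isomorphic_d16[of d5] associative_listed cbilinear_newton
       intro!: cbilinear_add cbilinear_scale cbilinear_psi,
     auto simp: d16_def d5_def coordinates)

lemma jump_d16_d6: "jump_deformation d16 d6"
  by (rule jump_deformationI[where bs = "newton 1 2 0"
        and u = "\<lambda>t. vector [t, 1, 2 * t]" and v = "\<lambda>t. vector [0, - t, 2 * t^2]" and w = "\<lambda>t. vector [0, 2 * t^2, 0]"])
    (auto simp: not_isomorphic_d16[of d6] associative_listed cbilinear_newton
       intro!: cbilinear_add cbilinear_scale cbilinear_psi,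
     auto simp: d16_def d6_def coordinates)

lemma jump_d16_d12: "jump_deformation d16 d12"
  by (rule jump_deformationI[where bs = "newton 2 1 1"
        and u = "\<lambda>t. vector [2 * t, t, 1]" and v = "\<lambda>t. vector [0, - (t^2), 0]" and w = "\<lambda>t. vector [0, 0, - (t^2)]"])
    (auto simp: not_isomorphic_d16[of d12] associative_listed cbilinear_newton
       intro!: cbilinear_add cbilinear_scale cbilinear_psi,
     auto simp: d16_def d12_def coordinates)

lemma jump_d16_d14: "jump_deformation d16 d14"
  by (rule jump_deformationI[where bs = "newton 1 2 3"
        and u = "\<lambda>t. vector [t, 2 * t, 3 * t]" and v = "\<lambda>t. vector [0, 2 * t^2, 6 * t^2]" and w = "\<lambda>t. vector [0, 0, 6 * t^3]"])
    (auto simp: not_isomorphic_d16[of d14] associative_listed cbilinear_newton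
       intro!: cbilinear_add cbilinear_scale cbilinear_psi,
     auto simp: d16_def d14_def coordinates)

lemma jump_d16_d19: "jump_deformation d16 d19"
  by (rule jump_deformationI[where bs = "newton 1 1 1"
        and u = "\<lambda>t. vector [1, 0, t]" and v = "\<lambda>t. vector [t, 1, 0]" and w = "\<lambda>t. vector [0, t, 0]"])
    (auto simp: not_isomorphic_d16[of d19] associative_listed cbilinear_newton
       intro!: cbilinear_add cbilinear_scale cbilinear_psi,
     auto simp: d16_def d19_def coordinates)

text \<open>In \<open>d17\<close> and \<open>d18\<close> the first basis vector is \<open>u + n\<close> with an idempotent \<open>u\<close> and the nilpotent
\<open>n\<close>, the second basis vector, for which \<open>u n = n u = n\<close>. So a change of the product \<open>n n\<close> alone
affects all products of the first two basis vectors. Here \<open>n n = t n\<close>.\<close>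
lemma jump_d17_d11: "jump_deformation d17 d11"
  by (rule jump_deformationI[where bs = "[psi 1 1 2 + psi 1 2 2 + psi 2 1 2 + psi 2 2 2]"
        and u = "\<lambda>t. vector [1 + t, 1, 0]" and v = "\<lambda>t. vector [t, 0, 0]" and w = "\<lambda>t. vector [0, 0, 1]"])
    (auto simp: not_isomorphic_d17 associative_listed cbilinear_newton
       intro!: cbilinear_add cbilinear_scale cbilinear_psi,
     auto simp: d17_def d11_def coordinates)

text \<open>\<open>d18\<close> is unital with the two nilpotents \<open>n\<close> and \<open>m\<close>, all of whose products vanish. The deformations set
\<open>n n = t n\<close> for \<open>d12\<close>, in addition \<open>n m = t m\<close> for \<open>d13\<close> or \<open>m m = t m\<close> for \<open>d14\<close>, and
\<open>n n = t m\<close> for \<open>d19\<close>.\<close>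
lemma jump_d18_d12: "jump_deformation d18 d12"
  by (rule jump_deformationI[where bs = "[psi 1 1 2 + psi 1 2 2 + psi 2 1 2 + psi 2 2 2]"
        and u = "\<lambda>t. vector [1 + t, 1, 0]" and v = "\<lambda>t. vector [t, 0, 0]" and w = "\<lambda>t. vector [0, 0, 1]"])
    (auto simp: not_isomorphic_d18[of d12] associative_listed cbilinear_newton
       intro!: cbilinear_add cbilinear_scale cbilinear_psi,
     auto simp: d18_def d12_def coordinates)

lemma jump_d18_d13: "jump_deformation d18 d13"
  by (rule jump_deformationI[where bs = "[psi 1 1 2 + psi 1 2 2 + psi 2 1 2 + psi 2 2 2 + psi 1 3 3 + psi 2 3 3]"
        and u = "\<lambda>t. vector [1, 1 + t, 0]" and v = "\<lambda>t. vector [0, t, 0]" and w = "\<lambda>t. vector [0, 0, 1]"])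
    (auto simp: not_isomorphic_d18[of d13] associative_listed cbilinear_newton
       intro!: cbilinear_add cbilinear_scale cbilinear_psi,
     auto simp: d18_def d13_def coordinates)

lemma jump_d18_d14: "jump_deformation d18 d14"
  by (rule jump_deformationI[where bs = "[psi 1 1 2 + psi 1 2 2 + psi 2 1 2 + psi 2 2 2 + psi 3 3 3]"
        and u = "\<lambda>t. vector [1 + t, 1, 1]" and v = "\<lambda>t. vector [t, 0, 0]" and w = "\<lambda>t. vector [0, 0, t]"])
    (auto simp: not_isomorphic_d18[of d14] associative_listed cbilinear_newton
       intro!: cbilinear_add cbilinear_scale cbilinear_psi,
     auto simp: d18_def d14_def coordinates)

lemma jump_d18_d19: "jump_deformation d18 d19"
  by (rule jump_deformationI[where bs = "[psi 1 1 3 + psi 1 2 3 + psi 2 1 3 + psi 2 2 3]"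
        and u = "\<lambda>t. vector [t, 0, 1]" and v = "\<lambda>t. vector [t, 0, 0]" and w = "\<lambda>t. vector [0, t, 0]"])
    (auto simp: not_isomorphic_d18_d19 associative_listed cbilinear_newton
       intro!: cbilinear_add cbilinear_scale cbilinear_psi,
     auto simp: d18_def d19_def coordinates)

text \<open>\<open>d19\<close> is \<open>\<complex>[x]/(x\<^sup>3)\<close>, with the third basis vector as unit. The modulus deforms to \<open>x\<^sup>2(x - t)\<close> here and
to \<open>x(x - t)(x - 2t)\<close> for \<open>d14\<close>, in the basis \<open>x, x(x - t)\<close> of the ideal generated by \<open>x\<close>.\<close>
lemma jump_d19_d12: "jump_deformation d19 d12"
  by (rule jump_deformationI[where bs = "[psi 1 1 1]"
        and u = "\<lambda>t. vector [t, 0, 1]" and v = "\<lambda>t. vector [0, 0, - t]" and w = "\<lambda>t. vector [1, 1, 0]"])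
    (auto simp: not_isomorphic_d19[of d12] associative_listed cbilinear_newton
       intro!: cbilinear_add cbilinear_scale cbilinear_psi,
     auto simp: d19_def d12_def coordinates)

lemma jump_d19_d14: "jump_deformation d19 d14"
  by (rule jump_deformationI[where bs = "[psi 1 1 1 + scale 2 (psi 1 2 2 + psi 2 1 2), scale 2 (psi 2 2 2)]"
        and u = "\<lambda>t. vector [0, t, 2 * t]" and v = "\<lambda>t. vector [0, 0, 2 * t^2]" and w = "\<lambda>t. vector [1, 1, 1]"])
    (auto simp: not_isomorphic_d19[of d14] associative_listed cbilinear_newton
       intro!: cbilinear_add cbilinear_scale cbilinear_psi,
     auto simp: d19_def d14_def coordinates)

theorem mainTheorem3:
  "(\<forall>d' \<in> {d2, d6, d10, d11, d12, d14}. jump_deformation d1 d') \<and>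
   (\<forall>d' \<in> {d6, d12, d14}. jump_deformation d2 d') \<and>
   (\<forall>d' \<in> {d11, d13}. jump_deformation d3 d') \<and>
   (\<forall>d' \<in> {d10, d13}. jump_deformation d4 d') \<and>
   (\<forall>d' \<in> {d6, d12, d14}. jump_deformation d5 d') \<and>
   {d' \<in> listed_products. jump_deformation d6 d'} = {d14} \<and>
   {d' \<in> listed_products. jump_deformation d9 d'} = {d10} \<and>
   {d' \<in> listed_products. jump_deformation d12 d'} = {d14} \<and>
   (\<forall>d' \<in> {d2, d5, d6, d12, d14, d19}. jump_deformation d16 d') \<and>
   {d' \<in> listed_products. jump_deformation d17 d'} = {d11} \<and>
   (\<forall>d' \<in> {d12, d13, d14, d19}. jump_deformation d18 d') \<and>
   (\<forall>d' \<in> {d12, d14}. jump_deformation d19 d')"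
proof -
  have "{d' \<in> listed_products. jump_deformation d6 d'} = {d14}"
    using jump_d6_only jump_d6_d14 by auto
  moreover have "{d' \<in> listed_products. jump_deformation d9 d'} = {d10}"
    using jump_d9_only jump_d9_d10 by auto
  moreover have "{d' \<in> listed_products. jump_deformation d12 d'} = {d14}"
    using jump_d12_only jump_d12_d14 by auto
  moreover have "{d' \<in> listed_products. jump_deformation d17 d'} = {d11}"
    using jump_d17_only jump_d17_d11 by auto
  ultimately show ?thesis
    by (simp add: jump_d1_d2 jump_d1_d6 jump_d1_d10 jump_d1_d11 jump_d1_d12 jump_d1_d14 jump_d2_d6 jump_d2_d12 jump_d2_d14 jump_d3_d11 jump_d3_d13 jump_d4_d10 jump_d4_d13 jump_d5_d6 jump_d5_d12 jump_d5_d14 jump_d16_d2 jump_d16_d5 jump_d16_d6 jump_d16_d12 jump_d16_d14 jump_d16_d19 jump_d18_d12 jump_d18_d13 jump_d18_d14 jump_d18_d19 jump_d19_d12 jump_d19_d14)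
qed

end
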